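(* Any Superposed Term Rewrite System (STRS) compatible with a monotonic assignment terminates.
   Context: **Syntax.** $\mathcal X$ is a countable set of variables; $\mathcal A,\mathcal C,\mathcal F$ are pairwise disjoint signatures (symbols $b$ with arity $\mathrm{ar}(b)\in\mathbb N$) of amplitude, constructor and function symbols. Constructors include a unit $()$, $|0\rangle$, $|1\rangle$, $\mathtt 0$ (arity 0), $\mathtt S$ (arity 1), pairing $(\cdot,\cdot)$ (arity 2), $[\,]$ (arity 0) and list-cons $h::t$ (arity 2). Grammar: naturals $\iota::=x\mid\mathtt 0\mid\mathtt S(\iota)$; amplitudes $\alpha::=\mathtt a(\iota,\dots,\iota)\mid\alpha\cdot\alpha\mid\alpha+\alpha$; terms $t::=x\mid c(t,\dots,t)\mid f(t,\dots,t)\mid\alpha\cdot t\mid t+t$; values $v::=c(v,\dots,v)\mid\alpha\cdot v\ (\alpha\text{ ground})\mid v+v$. A term or amplitude is ground if it has no variable; $\mathscr T_0$ is the set of ground terms. A term is classical if it contains neither $+$ nor $\alpha\cdot$. A substitution $\sigma$ maps variables to values. **Amplitudes.** Each $\mathtt a\in\mathcal A$ has a total interpretation $[\![\mathtt a]\!]:\mathbb N^{\mathrm{ar}(\mathtt a)}\to\mathbb C$, extended to ground amplitudes in the obvious way (sums to sums, products to products, $\mathtt S^n(\mathtt 0)$ to $n$). For a non-ground $\alpha$, $[\![\alpha]\!]=\lambda$ means $[\![\alpha\sigma]\!]=\lambda$ for every $\sigma$ such that $\alpha\sigma$ is a ground amplitude. **Equivalence.** $\equiv$ is the smallest equivalence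 relation on terms, closed under all term contexts ($s\equiv t\Rightarrow C[s]\equiv C[t]$), with: $t_1+t_2\equiv t_2+t_1$; $t_1+(t_2+t_3)\equiv(t_1+t_2)+t_3$; $s+\alpha\cdot t\equiv s$ if $[\![\alpha]\!]=0$; $\alpha\cdot t\equiv t$ if $[\![\alpha]\!]=1$; $\alpha\cdot(\beta\cdot t)\equiv(\alpha\cdot\beta)\cdot t$; $\alpha\cdot(t_1+t_2)\equiv\alpha\cdot t_1+\alpha\cdot t_2$; $\alpha\cdot t+\beta\cdot t\equiv(\alpha+\beta)\cdot t$; and, for $b\in\mathcal C\uplus\mathcal F$, $b(\dots,\alpha\cdot t,\dots)\equiv\alpha\cdot b(\dots,t,\dots)$ and $b(\dots,t_1+t_2,\dots)\equiv b(\dots,t_1,\dots)+b(\dots,t_2,\dots)$. A canonical form of $t$ is a term $\sum_{i=1}^n\alpha_i\cdot t_i\equiv t$ with the $t_i$ pairwise distinct classical terms and $[\![\alpha_i]\!]\neq0$; $\mathrm{CAN}$ is the set of canonical forms. **STRS.** A rewrite rule is $l\to r$ with $l=f(p_1,\dots,p_n)$, $f\in\mathcal F$, each $p_i$ a classical term without function symbols, and $\mathrm{Var}(r)\subseteq\mathrm{Var}(l)$. An STRS $\mathfrak R$ consists of $\mathcal A,\mathcal C,\mathcal F,\mathcal X$, a set $\mathcal R$ of orthogonal rules (left-linear and with pairwise non-overlapping left-hand sides), and a main symbol $f\in\mathcal F$. **Reduction.** Evaluation contexts: $E::=\diamond\mid b(v_1,\dots,v_{i-1},E,t_{i+1},\dots,t_n)$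 with $b\in\mathcal C\uplus\mathcal F$ and $v_j$ values. $\to_{\mathfrak R}\subseteq\mathscr T_0\times\mathscr T_0$ is defined inductively by: (C) if $l\to r\in\mathcal R$ and $E[l\sigma]$ is classical then $E[l\sigma]\to_{\mathfrak R}E[r\sigma]$; (E) if $s\equiv s'\to_{\mathfrak R}t'\equiv t$ then $s\to_{\mathfrak R}t$; (Q) if $\sum_i\alpha_i\cdot s_i\in\mathrm{CAN}$, $s_i\to^?_{\mathfrak R}t_i$ for all $i$, and $s_i\to_{\mathfrak R}t_i$ for some $i$, then $\sum_i\alpha_i\cdot s_i\to_{\mathfrak R}\sum_i\alpha_i\cdot t_i$. Here $s\to^?_{\mathfrak R}t$ iff ($s\in\mathrm{NF}_{\mathfrak R}$ and $t=s$) or $s\to_{\mathfrak R}t$, and $\mathrm{NF}_{\mathfrak R}$ is the set of ground terms with no $\to_{\mathfrak R}$-reduct. A term terminates if, for some $k\in\mathbb N$, all reduction chains from it reach a normal form in at most $k$ steps; an STRS terminates if every ground term terminates. **Assignments.** For polynomials $P,Q$ with coefficients in $\mathbb N$, $P\succ_{\mathbb N}Q$ (resp. $P\succeq_{\mathbb N}Q$) means $P(\overline x)>Q(\overline x)$ (resp. $\ge$) for all values $\overline x$ of the indeterminates in $\mathbb N$. An assignment $\langle\!\langle-\rangle\!\rangle$ maps each $b\in\mathcal C\uplus\mathcal F$ to a polynomial $\langle\!\langle b\rangle\!\rangle\in\mathbb N[X_1,\dots,X_{\mathrm{ar}(b)}]$. With a fixed map $\rho$ from variables to indeterminates, it extends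 to terms by $\langle\!\langle x\rangle\!\rangle=\rho(x)$, $\langle\!\langle b(s_1,\dots,s_n)\rangle\!\rangle=\langle\!\langle b\rangle\!\rangle(\langle\!\langle s_1\rangle\!\rangle,\dots,\langle\!\langle s_n\rangle\!\rangle)$, and $\langle\!\langle t\rangle\!\rangle=\max_i\langle\!\langle t_i\rangle\!\rangle$ if $t\equiv\sum_i\alpha_i\cdot t_i\in\mathrm{CAN}$, where $\max_i\langle\!\langle t_i\rangle\!\rangle$ denotes a polynomial $P$ with $P\succeq_{\mathbb N}\langle\!\langle t_i\rangle\!\rangle$ for all $i$. The induced orders on terms are $s\succeq t\iff\langle\!\langle s\rangle\!\rangle\succeq_{\mathbb N}\langle\!\langle t\rangle\!\rangle$ and $s\succ t\iff\langle\!\langle s\rangle\!\rangle\succ_{\mathbb N}\langle\!\langle t\rangle\!\rangle$. The assignment is monotonic if $s\succ t$ implies $b(\dots,s,\dots)\succ b(\dots,t,\dots)$ for all terms $s,t$ and all $b\in\mathcal C\uplus\mathcal F$. An STRS is compatible with the assignment if $l\succ r$ for all its rules $l\to r$.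
   Formalization: The fixed map ρ from variables to indeterminates is assumed injective; otherwise the claim fails, e.g. for the rule f(S(x),y) → f(y,y) with ⟨⟨f⟩⟩ = X1+X2, ⟨⟨S⟩⟩ = X1+1 and ρ(x) = ρ(y). *)

theory Defs
  imports Complex_Main "HOL-Library.Poly_Mapping" "HOL-Library.Countable_Set"
begin

section \<open>Syntax\<close>

text \<open>
  The signatures of amplitude, constructor and function symbols live in different types, hence
  are disjoint. The arguments of an amplitude are pre-terms; the grammar below restricts them to
  natural expressions. In this way a substitution acts on every piece of syntax, and whether
  its result is still an amplitude (respectively a term) is a property of that result.
\<close>

datatype 'c constr =
  UnitC | Ket0C | Ket1C | ZeroC | SuccC | PairC | NilC | ConsC | OtherC 'c

datatype ('c, 'f) symbol = Constr "'c constr" | Func 'f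

datatype ('a, 'n) amp =
    Amp 'a "'n list"
  | AMult "('a, 'n) amp" "('a, 'n) amp"
  | AAdd "('a, 'n) amp" "('a, 'n) amp"

datatype (amp_syms: 'a, con_syms: 'c, fun_syms: 'f, vars: 'x) trm =
    Var 'x
  | App "('c, 'f) symbol" "('a, 'c, 'f, 'x) trm list"
  | Scale "('a, ('a, 'c, 'f, 'x) trm) amp" "('a, 'c, 'f, 'x) trm"
  | Plus "('a, 'c, 'f, 'x) trm" "('a, 'c, 'f, 'x) trm"

type_synonym ('a, 'c, 'f, 'x) tamp = "('a, ('a, 'c, 'f, 'x) trm) amp"

abbreviation zero_trm :: "('a, 'c, 'f, 'x) trm" where
  "zero_trm \<equiv> App (Constr ZeroC) []"

abbreviation succ_trm :: "('a, 'c, 'f, 'x) trm \<Rightarrow> ('a, 'c, 'f, 'x) trm" where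
  "succ_trm t \<equiv> App (Constr SuccC) [t]"

definition amp_vars :: "('a, 'c, 'f, 'x) tamp \<Rightarrow> 'x set" where
  "amp_vars \<alpha> = (\<Union>n \<in> set2_amp \<alpha>. vars n)"

primrec subst :: "('x \<Rightarrow> ('a, 'c, 'f, 'x) trm) \<Rightarrow> ('a, 'c, 'f, 'x) trm \<Rightarrow> ('a, 'c, 'f, 'x) trm"
  where
    "subst \<sigma> (Var x) = \<sigma> x"
  | "subst \<sigma> (App b ts) = App b (map (subst \<sigma>) ts)"
  | "subst \<sigma> (Scale \<alpha> t) = Scale (map_amp id (subst \<sigma>) \<alpha>) (subst \<sigma> t)"
  | "subst \<sigma> (Plus s t) = Plus (subst \<sigma> s) (subst \<sigma> t)"

definition subst_amp ::
  "('x \<Rightarrow> ('a, 'c, 'f, 'x) trm) \<Rightarrow> ('a, 'c, 'f, 'x) tamp \<Rightarrow> ('a, 'c, 'f, 'x) tamp" where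
  "subst_amp \<sigma> = map_amp id (subst \<sigma>)"

primrec classical :: "('a, 'c, 'f, 'x) trm \<Rightarrow> bool" where
    "classical (Var x) \<longleftrightarrow> True"
  | "classical (App b ts) \<longleftrightarrow> list_all id (map classical ts)"
  | "classical (Scale \<alpha> t) \<longleftrightarrow> False"
  | "classical (Plus s t) \<longleftrightarrow> False"

record ('a, 'c, 'f, 'x) strs =
  amps :: "'a set"
  amp_arity :: "'a \<Rightarrow> nat"
  amp_int :: "'a \<Rightarrow> nat list \<Rightarrow> complex"
  other_cons :: "'c set"
  other_arity :: "'c \<Rightarrow> nat"
  funs :: "'f set"
  fun_arity :: "'f \<Rightarrow> nat"
  variables :: "'x set"
  rules :: "(('a, 'c, 'f, 'x) trm \<times> ('a, 'c, 'f, 'x) trm) set"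
  main :: "'f"

primrec con_arity :: "('a, 'c, 'f, 'x) strs \<Rightarrow> 'c constr \<Rightarrow> nat" where
    "con_arity S UnitC = 0"
  | "con_arity S Ket0C = 0"
  | "con_arity S Ket1C = 0"
  | "con_arity S ZeroC = 0"
  | "con_arity S SuccC = 1"
  | "con_arity S PairC = 2"
  | "con_arity S NilC = 0"
  | "con_arity S ConsC = 2"
  | "con_arity S (OtherC c) = other_arity S c"

primrec arity :: "('a, 'c, 'f, 'x) strs \<Rightarrow> ('c, 'f) symbol \<Rightarrow> nat" where
    "arity S (Constr c) = con_arity S c"
  | "arity S (Func f) = fun_arity S f"

definition cons :: "('a, 'c, 'f, 'x) strs \<Rightarrow> 'c constr set" where
  "cons S = {UnitC, Ket0C, Ket1C, ZeroC, SuccC, PairC, NilC, ConsC} \<union> OtherC ` other_cons S"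

definition symbols :: "('a, 'c, 'f, 'x) strs \<Rightarrow> ('c, 'f) symbol set" where
  "symbols S = Constr ` cons S \<union> Func ` funs S"

inductive natexp :: "('a, 'c, 'f, 'x) strs \<Rightarrow> ('a, 'c, 'f, 'x) trm \<Rightarrow> bool" for S where
    natexp_Var: "x \<in> variables S \<Longrightarrow> natexp S (Var x)"
  | natexp_zero: "natexp S zero_trm"
  | natexp_succ: "natexp S n \<Longrightarrow> natexp S (succ_trm n)"

inductive amplitude :: "('a, 'c, 'f, 'x) strs \<Rightarrow> ('a, 'c, 'f, 'x) tamp \<Rightarrow> bool" for S where
    amplitude_Amp: "a \<in> amps S \<Longrightarrow> length ns = amp_arity S a \<Longrightarrow> \<forall>n \<in> set ns. natexp S n
      \<Longrightarrow> amplitude S (Amp a ns)"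
  | amplitude_AMult: "amplitude S \<alpha> \<Longrightarrow> amplitude S \<beta> \<Longrightarrow> amplitude S (AMult \<alpha> \<beta>)"
  | amplitude_AAdd: "amplitude S \<alpha> \<Longrightarrow> amplitude S \<beta> \<Longrightarrow> amplitude S (AAdd \<alpha> \<beta>)"

inductive wf_term :: "('a, 'c, 'f, 'x) strs \<Rightarrow> ('a, 'c, 'f, 'x) trm \<Rightarrow> bool" for S where
    wf_Var: "x \<in> variables S \<Longrightarrow> wf_term S (Var x)"
  | wf_App: "b \<in> symbols S \<Longrightarrow> length ts = arity S b \<Longrightarrow> \<forall>t \<in> set ts. wf_term S t
      \<Longrightarrow> wf_term S (App b ts)"
  | wf_Scale: "amplitude S \<alpha> \<Longrightarrow> wf_term S t \<Longrightarrow> wf_term S (Scale \<alpha> t)"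
  | wf_Plus: "wf_term S s \<Longrightarrow> wf_term S t \<Longrightarrow> wf_term S (Plus s t)"

definition ground_amp :: "('a, 'c, 'f, 'x) strs \<Rightarrow> ('a, 'c, 'f, 'x) tamp \<Rightarrow> bool" where
  "ground_amp S \<alpha> \<longleftrightarrow> amplitude S \<alpha> \<and> amp_vars \<alpha> = {}"

definition ground_term :: "('a, 'c, 'f, 'x) strs \<Rightarrow> ('a, 'c, 'f, 'x) trm \<Rightarrow> bool" where
  "ground_term S t \<longleftrightarrow> wf_term S t \<and> vars t = {}"

inductive val :: "('a, 'c, 'f, 'x) strs \<Rightarrow> ('a, 'c, 'f, 'x) trm \<Rightarrow> bool" for S where
    val_App: "c \<in> cons S \<Longrightarrow> length vs = con_arity S c \<Longrightarrow> \<forall>v \<in> set vs. val S v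
      \<Longrightarrow> val S (App (Constr c) vs)"
  | val_Scale: "ground_amp S \<alpha> \<Longrightarrow> val S v \<Longrightarrow> val S (Scale \<alpha> v)"
  | val_Plus: "val S v \<Longrightarrow> val S w \<Longrightarrow> val S (Plus v w)"

definition val_subst :: "('a, 'c, 'f, 'x) strs \<Rightarrow> ('x \<Rightarrow> ('a, 'c, 'f, 'x) trm) \<Rightarrow> bool" where
  "val_subst S \<sigma> \<longleftrightarrow> (\<forall>x \<in> variables S. val S (\<sigma> x))"


section \<open>Amplitudes\<close>

text \<open>Only the values of \<open>nat_of\<close> on the numerals \<open>S(...S(0))\<close> matter.\<close>

fun nat_of :: "('a, 'c, 'f, 'x) trm \<Rightarrow> nat" where
    "nat_of (App (Constr SuccC) [t]) = Suc (nat_of t)"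
  | "nat_of _ = 0"

primrec eval_amp :: "('a, 'c, 'f, 'x) strs \<Rightarrow> ('a, 'c, 'f, 'x) tamp \<Rightarrow> complex" where
    "eval_amp S (Amp a ns) = amp_int S a (map nat_of ns)"
  | "eval_amp S (AMult \<alpha> \<beta>) = eval_amp S \<alpha> * eval_amp S \<beta>"
  | "eval_amp S (AAdd \<alpha> \<beta>) = eval_amp S \<alpha> + eval_amp S \<beta>"

definition amp_is :: "('a, 'c, 'f, 'x) strs \<Rightarrow> ('a, 'c, 'f, 'x) tamp \<Rightarrow> complex \<Rightarrow> bool" where
  "amp_is S \<alpha> z \<longleftrightarrow>
    (\<forall>\<sigma>. val_subst S \<sigma> \<and> ground_amp S (subst_amp \<sigma> \<alpha>) \<longrightarrow> eval_amp S (subst_amp \<sigma> \<alpha>) = z)"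


section \<open>Equivalence and canonical forms\<close>

inductive equi :: "('a, 'c, 'f, 'x) strs \<Rightarrow> ('a, 'c, 'f, 'x) trm \<Rightarrow> ('a, 'c, 'f, 'x) trm \<Rightarrow> bool"
  for S where
    equi_refl: "wf_term S t \<Longrightarrow> equi S t t"
  | equi_sym: "equi S s t \<Longrightarrow> equi S t s"
  | equi_trans: "equi S s t \<Longrightarrow> equi S t u \<Longrightarrow> equi S s u"
  | equi_App: "equi S s t \<Longrightarrow> wf_term S (App b (us @ s # ws))
      \<Longrightarrow> equi S (App b (us @ s # ws)) (App b (us @ t # ws))"
  | equi_Scale: "equi S s t \<Longrightarrow> amplitude S \<alpha> \<Longrightarrow> equi S (Scale \<alpha> s) (Scale \<alpha> t)"
  | equi_Plus1: "equi S s t \<Longrightarrow> wf_term S u \<Longrightarrow> equi S (Plus s u) (Plus t u)"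
  | equi_Plus2: "equi S s t \<Longrightarrow> wf_term S u \<Longrightarrow> equi S (Plus u s) (Plus u t)"
  | add_comm: "wf_term S (Plus s t) \<Longrightarrow> equi S (Plus s t) (Plus t s)"
  | add_assoc: "wf_term S (Plus s (Plus t u)) \<Longrightarrow> equi S (Plus s (Plus t u)) (Plus (Plus s t) u)"
  | add_null: "wf_term S (Plus s (Scale \<alpha> t)) \<Longrightarrow> amp_is S \<alpha> 0
      \<Longrightarrow> equi S (Plus s (Scale \<alpha> t)) s"
  | scale_one: "wf_term S (Scale \<alpha> t) \<Longrightarrow> amp_is S \<alpha> 1 \<Longrightarrow> equi S (Scale \<alpha> t) t"
  | scale_scale: "wf_term S (Scale \<alpha> (Scale \<beta> t))
      \<Longrightarrow> equi S (Scale \<alpha> (Scale \<beta> t)) (Scale (AMult \<alpha> \<beta>) t)"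
  | scale_add: "wf_term S (Scale \<alpha> (Plus s t))
      \<Longrightarrow> equi S (Scale \<alpha> (Plus s t)) (Plus (Scale \<alpha> s) (Scale \<alpha> t))"
  | add_scale: "wf_term S (Plus (Scale \<alpha> t) (Scale \<beta> t))
      \<Longrightarrow> equi S (Plus (Scale \<alpha> t) (Scale \<beta> t)) (Scale (AAdd \<alpha> \<beta>) t)"
  | App_scale: "wf_term S (App b (us @ Scale \<alpha> t # ws))
      \<Longrightarrow> equi S (App b (us @ Scale \<alpha> t # ws)) (Scale \<alpha> (App b (us @ t # ws)))"
  | App_add: "wf_term S (App b (us @ Plus s t # ws))
      \<Longrightarrow> equi S (App b (us @ Plus s t # ws))
                (Plus (App b (us @ s # ws)) (App b (us @ t # ws)))"

text \<open>
  The syntax has no empty sum, so a linear combination has at least one summand. The nesting of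
  the binary sums is immaterial, since both uses of canonical forms below are closed under the
  equivalence.
\<close>

fun lincomb :: "(('a, 'c, 'f, 'x) tamp \<times> ('a, 'c, 'f, 'x) trm) list \<Rightarrow> ('a, 'c, 'f, 'x) trm" where
    "lincomb [(\<alpha>, t)] = Scale \<alpha> t"
  | "lincomb ((\<alpha>, t) # p # ps) = Plus (Scale \<alpha> t) (lincomb (p # ps))"

text \<open>
  For an amplitude with variables, having a value different from \<open>0\<close> is read as the negation of
  having the value \<open>0\<close>: the amplitude may vanish under some substitutions but not under all.
\<close>

definition canonical ::
  "('a, 'c, 'f, 'x) strs \<Rightarrow> (('a, 'c, 'f, 'x) tamp \<times> ('a, 'c, 'f, 'x) trm) list \<Rightarrow> bool" where
  "canonical S ps \<longleftrightarrow> ps \<noteq> [] \<and> distinct (map snd ps) \<and>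
    (\<forall>(\<alpha>, t) \<in> set ps. amplitude S \<alpha> \<and> \<not> amp_is S \<alpha> 0 \<and> wf_term S t \<and> classical t)"


section \<open>Superposed term rewrite systems\<close>

definition is_rule ::
  "('a, 'c, 'f, 'x) strs \<Rightarrow> ('a, 'c, 'f, 'x) trm \<Rightarrow> ('a, 'c, 'f, 'x) trm \<Rightarrow> bool" where
  "is_rule S l r \<longleftrightarrow> wf_term S l \<and> wf_term S r \<and> vars r \<subseteq> vars l \<and>
    (\<exists>f ps. l = App (Func f) ps \<and> (\<forall>p \<in> set ps. classical p \<and> fun_syms p = {}))"

inductive linear_term :: "('a, 'c, 'f, 'x) trm \<Rightarrow> bool" where
    linear_Var: "linear_term (Var x)"
  | linear_App: "\<forall>t \<in> set ts. linear_term t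
      \<Longrightarrow> \<forall>i j. i < j \<and> j < length ts \<longrightarrow> vars (ts ! i) \<inter> vars (ts ! j) = {}
      \<Longrightarrow> linear_term (App b ts)"

inductive subterm :: "('a, 'c, 'f, 'x) trm \<Rightarrow> ('a, 'c, 'f, 'x) trm \<Rightarrow> bool" where
    subterm_refl: "subterm t t"
  | subterm_App: "subterm u t \<Longrightarrow> t \<in> set ts \<Longrightarrow> subterm u (App b ts)"
  | subterm_Scale: "subterm u t \<Longrightarrow> subterm u (Scale \<alpha> t)"
  | subterm_Plus1: "subterm u s \<Longrightarrow> subterm u (Plus s t)"
  | subterm_Plus2: "subterm u t \<Longrightarrow> subterm u (Plus s t)"

text \<open>
  Two independent substitutions account for renaming the two rules apart. The only overlap
  permitted is the trivial one of a rule with itself at the root.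
\<close>

definition non_overlapping :: "('a, 'c, 'f, 'x) strs \<Rightarrow> bool" where
  "non_overlapping S \<longleftrightarrow>
    (\<forall>l r l' r' u \<sigma> \<tau>. (l, r) \<in> rules S \<and> (l', r') \<in> rules S \<and> subterm u l \<and> (\<nexists>x. u = Var x) \<and>
      (\<forall>x \<in> variables S. wf_term S (\<sigma> x) \<and> wf_term S (\<tau> x)) \<and> subst \<sigma> u = subst \<tau> l' \<longrightarrow>
      u = l \<and> (l, r) = (l', r'))"

definition is_strs :: "('a, 'c, 'f, 'x) strs \<Rightarrow> bool" where
  "is_strs S \<longleftrightarrow> countable (variables S) \<and> main S \<in> funs S \<and>
    (\<forall>(l, r) \<in> rules S. is_rule S l r \<and> linear_term l) \<and> non_overlapping S"


section \<open>Reduction\<close>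

datatype ('a, 'c, 'f, 'x) ctx =
    Hole
  | CApp "('c, 'f) symbol" "('a, 'c, 'f, 'x) trm list" "('a, 'c, 'f, 'x) ctx"
      "('a, 'c, 'f, 'x) trm list"

primrec fill :: "('a, 'c, 'f, 'x) ctx \<Rightarrow> ('a, 'c, 'f, 'x) trm \<Rightarrow> ('a, 'c, 'f, 'x) trm" where
    "fill Hole t = t"
  | "fill (CApp b vs E ts) t = App b (vs @ fill E t # ts)"

inductive eval_ctx :: "('a, 'c, 'f, 'x) strs \<Rightarrow> ('a, 'c, 'f, 'x) ctx \<Rightarrow> bool" for S where
    eval_Hole: "eval_ctx S Hole"
  | eval_CApp: "b \<in> symbols S \<Longrightarrow> length vs + 1 + length ts = arity S b \<Longrightarrow> \<forall>v \<in> set vs. val S v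
      \<Longrightarrow> eval_ctx S E \<Longrightarrow> \<forall>t \<in> set ts. wf_term S t \<Longrightarrow> eval_ctx S (CApp b vs E ts)"

definition NF :: "('a, 'c, 'f, 'x) strs \<Rightarrow>
    (('a, 'c, 'f, 'x) trm \<Rightarrow> ('a, 'c, 'f, 'x) trm \<Rightarrow> bool) \<Rightarrow> ('a, 'c, 'f, 'x) trm set" where
  "NF S R = {t. ground_term S t \<and> (\<nexists>u. R t u)}"

text \<open>
  Rule \<open>Q\<close> refers to normal forms, that is, negatively to the relation being defined. The
  inductive definition therefore takes the set \<open>N\<close> of normal forms as a parameter, and the
  reduction relation \<open>red\<close> is the relation for which \<open>N\<close> is its own set of normal forms. Lemma
  \<open>ex1_red\<close> shows that there is exactly one: \<open>Q\<close> inspects only classical terms, and their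
  reducibility is decided by rule \<open>C\<close> alone.
\<close>

inductive step :: "('a, 'c, 'f, 'x) strs \<Rightarrow> ('a, 'c, 'f, 'x) trm set \<Rightarrow>
    ('a, 'c, 'f, 'x) trm \<Rightarrow> ('a, 'c, 'f, 'x) trm \<Rightarrow> bool" for S N where
    C: "(l, r) \<in> rules S \<Longrightarrow> eval_ctx S E \<Longrightarrow> val_subst S \<sigma> \<Longrightarrow> classical (fill E (subst \<sigma> l))
      \<Longrightarrow> ground_term S (fill E (subst \<sigma> l)) \<Longrightarrow> ground_term S (fill E (subst \<sigma> r))
      \<Longrightarrow> step S N (fill E (subst \<sigma> l)) (fill E (subst \<sigma> r))"
  | E: "ground_term S s \<Longrightarrow> ground_term S t \<Longrightarrow> equi S s s' \<Longrightarrow> step S N s' t' \<Longrightarrow> equi S t' t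
      \<Longrightarrow> step S N s t"
  | Q: "length ss = length \<alpha>s \<Longrightarrow> length ts = length \<alpha>s \<Longrightarrow> canonical S (zip \<alpha>s ss)
      \<Longrightarrow> ground_term S (lincomb (zip \<alpha>s ss)) \<Longrightarrow> ground_term S (lincomb (zip \<alpha>s ts))
      \<Longrightarrow> \<forall>i < length \<alpha>s. (ss ! i \<in> N \<and> ts ! i = ss ! i) \<or> step S N (ss ! i) (ts ! i)
      \<Longrightarrow> i < length \<alpha>s \<Longrightarrow> step S N (ss ! i) (ts ! i)
      \<Longrightarrow> step S N (lincomb (zip \<alpha>s ss)) (lincomb (zip \<alpha>s ts))"

definition red :: "('a, 'c, 'f, 'x) strs \<Rightarrow> ('a, 'c, 'f, 'x) trm \<Rightarrow> ('a, 'c, 'f, 'x) trm \<Rightarrow> bool"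
  where "red S = (THE R. R = step S (NF S R))"

text \<open>
  For the proof of \<open>ex1_red\<close>: up to equivalence, a term is a formal combination of
  classical terms. The function \<open>coef\<close> gives the coefficients after all variables in amplitudes are
  instantiated by \<open>0\<close>, which does not affect ground terms.
\<close>

primrec coef :: "('a, 'c, 'f, 'x) strs \<Rightarrow> ('a, 'c, 'f, 'x) trm \<Rightarrow> ('a, 'c, 'f, 'x) trm \<Rightarrow> complex"
  where
    "coef S (Var x) = (\<lambda>u. of_bool (u = Var x))"
  | "coef S (App b ts) = (\<lambda>u. case u of
        App b' us \<Rightarrow> if b' = b \<and> length us = length ts
          then prod_list (map2 (\<lambda>f v. f v) (map (coef S) ts) us) else 0
      | _ \<Rightarrow> 0)"
  | "coef S (Scale \<alpha> t) = (\<lambda>u. eval_amp S (subst_amp (\<lambda>_. zero_trm) \<alpha>) * coef S t u)"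
  | "coef S (Plus s t) = (\<lambda>u. coef S s u + coef S t u)"

lemma coef_App_split:
  "\<exists>K. \<forall>t. coef S (App b (us @ t # ws)) u = K * (case u of App b' vs \<Rightarrow> coef S t (vs ! length us) | _ \<Rightarrow> 0)"
proof (cases "\<exists>vs. u = App b vs \<and> length vs = length us + Suc (length ws)")
  case True
  then obtain vs where u: "u = App b vs" and len: "length vs = length us + Suc (length ws)"
    by blast
  define n where "n = length us"
  have vs: "vs = take n vs @ vs ! n # drop (Suc n) vs"
    using len by (intro id_take_nth_drop) (simp add: n_def)
  have "coef S (App b (us @ t # ws)) u
      = prod_list (map2 (\<lambda>f v. f v) (map (coef S) us) (take n vs))
        * prod_list (map2 (\<lambda>f v. f v) (map (coef S) ws) (drop (Suc n) vs)) * coef S t (vs ! n)" for t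
  proof -
    have "map2 (\<lambda>f v. f v) (map (coef S) (us @ t # ws)) vs
        = map2 (\<lambda>f v. f v) (map (coef S) (us @ t # ws)) (take n vs @ vs ! n # drop (Suc n) vs)"
      using vs by simp
    also have "\<dots> = map2 (\<lambda>f v. f v) (map (coef S) us) (take n vs) @ coef S t (vs ! n) #
        map2 (\<lambda>f v. f v) (map (coef S) ws) (drop (Suc n) vs)"
      using len by (simp add: n_def zip_append)
    finally show ?thesis using u len by simp
  qed
  then show ?thesis using u unfolding n_def by auto
next
  case False
  then have "coef S (App b (us @ t # ws)) u = 0" for t by (auto split: trm.splits)
  then show ?thesis by (metis mult_zero_left)
qed

lemma natexp_instance: "natexp S n \<Longrightarrow> natexp S (subst (\<lambda>_. zero_trm) n) \<and> vars (subst (\<lambda>_. zero_trm) n) = {}"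
  by (induction rule: natexp.induct) (auto intro: natexp.intros)

lemma amplitude_instance:
  "amplitude S \<alpha> \<Longrightarrow> ground_amp S (subst_amp (\<lambda>_. zero_trm) \<alpha>)"
  unfolding ground_amp_def amp_vars_def subst_amp_def
  by (induction rule: amplitude.induct) (auto intro!: amplitude.intros simp: natexp_instance)

lemma val_zero: "val S zero_trm"
  by (rule val_App) (auto simp: cons_def)

lemma amp_is_instance:
  "amplitude S \<alpha> \<Longrightarrow> amp_is S \<alpha> z \<Longrightarrow> eval_amp S (subst_amp (\<lambda>_. zero_trm) \<alpha>) = z"
  using amplitude_instance[of S \<alpha>] val_zero[of S] by (auto simp: amp_is_def val_subst_def)

lemma coef_equi: "equi S s t \<Longrightarrow> coef S s = coef S t"
proof (induction rule: equi.induct)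
  case (equi_App s t b us ws)
  show ?case
  proof
    fix u
    obtain K where "\<forall>t. coef S (App b (us @ t # ws)) u = K * (case u of App b' vs \<Rightarrow> coef S t (vs ! length us) | _ \<Rightarrow> 0)"
      using coef_App_split[of S b us ws u] by blast
    then show "coef S (App b (us @ s # ws)) u = coef S (App b (us @ t # ws)) u"
      using equi_App.IH by (simp del: coef.simps(2) split: trm.split)
  qed
next
  case (add_null s \<alpha> t)
  then show ?case by (auto elim!: wf_term.cases[of S "Plus _ _"] wf_term.cases[of S "Scale _ _"] dest: amp_is_instance)
next
  case (scale_one \<alpha> t)
  then show ?case by (auto elim!: wf_term.cases[of S "Scale _ _"] dest: amp_is_instance)
next
  case (App_scale b us \<alpha> t ws)
  show ?case
  proof
    fix u
    obtain K where "\<forall>t. coef S (App b (us @ t # ws)) u = K * (case u of App b' vs \<Rightarrow> coef S t (vs ! length us) | _ \<Rightarrow> 0)"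
      using coef_App_split[of S b us ws u] by blast
    then show "coef S (App b (us @ Scale \<alpha> t # ws)) u = coef S (Scale \<alpha> (App b (us @ t # ws))) u"
      by (simp add: coef.simps(3) del: coef.simps(2) split: trm.split)
  qed
next
  case (App_add b us s t ws)
  show ?case
  proof
    fix u
    obtain K where "\<forall>t. coef S (App b (us @ t # ws)) u = K * (case u of App b' vs \<Rightarrow> coef S t (vs ! length us) | _ \<Rightarrow> 0)"
      using coef_App_split[of S b us ws u] by blast
    then show "coef S (App b (us @ Plus s t # ws)) u
        = coef S (Plus (App b (us @ s # ws)) (App b (us @ t # ws))) u"
      by (simp add: algebra_simps del: coef.simps(2) split: trm.split)
  qed
qed (auto simp: subst_amp_def algebra_simps)

lemma prod_list_map2_of_bool:
  assumes "length us = length ts" and "\<And>t u. t \<in> set ts \<Longrightarrow> c t u = (of_bool (u = t) :: complex)"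
  shows "prod_list (map2 (\<lambda>f v. f v) (map c ts) us) = of_bool (us = ts)"
  using assms by (induction us ts rule: list_induct2) auto

lemma coef_classical: "classical t \<Longrightarrow> coef S t u = of_bool (u = t)"
proof (induction t arbitrary: u)
  case (App b ts)
  then have "t \<in> set ts \<Longrightarrow> coef S t u = of_bool (u = t)" for t u
    by (auto simp: list_all_iff)
  then show ?case
    by (auto simp: prod_list_map2_of_bool split: trm.split)
qed auto

lemma coef_lincomb:
  "ps \<noteq> [] \<Longrightarrow> coef S (lincomb ps) u
    = (\<Sum>(\<alpha>, t) \<leftarrow> ps. eval_amp S (subst_amp (\<lambda>_. zero_trm) \<alpha>) * coef S t u)"
  by (induction ps rule: lincomb.induct) auto

lemma subst_ground: "vars t = {} \<Longrightarrow> subst \<sigma> t = t"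
proof (induction t)
  case (App b ts)
  then show ?case by (auto intro: map_idI)
next
  case (Scale \<alpha> t)
  then have "map_amp id (subst \<sigma>) \<alpha> = map_amp id id \<alpha>"
    by (intro amp.map_cong) auto
  with Scale show ?case by (simp add: amp.map_id)
qed auto

lemma subst_amp_ground: "amp_vars \<alpha> = {} \<Longrightarrow> subst_amp \<sigma> \<alpha> = \<alpha>"
  unfolding amp_vars_def subst_amp_def
proof -
  assume "(\<Union>n \<in> set2_amp \<alpha>. vars n) = {}"
  then have "map_amp id (subst \<sigma>) \<alpha> = map_amp id id \<alpha>"
    by (intro amp.map_cong) (auto simp: subst_ground)
  then show "map_amp id (subst \<sigma>) \<alpha> = \<alpha>"
    by (simp add: amp.map_id)
qed

lemma vars_lincomb: "p \<in> set ps \<Longrightarrow> amp_vars (fst p) \<subseteq> vars (lincomb ps)"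
  by (induction ps rule: lincomb.induct) (auto simp: amp_vars_def)

lemma coef_canonical:
  assumes "canonical S ps" and "vars (lincomb ps) = {}" and "(\<alpha>, t) \<in> set ps"
  shows "coef S (lincomb ps) t \<noteq> 0"
proof -
  let ?e = "\<lambda>\<alpha>. eval_amp S (subst_amp (\<lambda>_. zero_trm) \<alpha>)"
  have dist: "distinct (map snd ps)" and ne: "ps \<noteq> []"
    using assms(1) by (auto simp: canonical_def)
  have cl: "classical u" if "(\<beta>, u) \<in> set ps" for \<beta> u
    using assms(1) that by (auto simp: canonical_def)
  have "coef S (lincomb ps) t = (\<Sum>(\<beta>, u) \<leftarrow> ps. ?e \<beta> * coef S u t)"
    using ne by (rule coef_lincomb)
  also have "\<dots> = (\<Sum>(\<beta>, u) \<in> set ps. ?e \<beta> * coef S u t)"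
    using dist by (simp add: distinct_map sum_list_distinct_conv_sum_set)
  also have "\<dots> = (\<Sum>p \<in> set ps. if p = (\<alpha>, t) then ?e \<alpha> else 0)"
  proof (rule sum.cong)
    fix p assume p: "p \<in> set ps"
    obtain \<beta> u where [simp]: "p = (\<beta>, u)" by (cases p)
    have "u = t \<Longrightarrow> p = (\<alpha>, t)"
      using dist p assms(3) inj_onD[of snd "set ps" p "(\<alpha>, t)"] by (simp add: distinct_map)
    then show "(case p of (\<beta>, u) \<Rightarrow> ?e \<beta> * coef S u t) = (if p = (\<alpha>, t) then ?e \<alpha> else 0)"
      using cl[of \<beta> u] p by (auto simp: coef_classical)
  qed simp
  also have "\<dots> = ?e \<alpha>"
    using assms(3) by simp
  also have "\<dots> \<noteq> 0"
  proof -
    have "amp_vars \<alpha> = {}"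
      using vars_lincomb[OF assms(3)] assms(2) by simp
    moreover have "\<not> amp_is S \<alpha> 0"
      using assms(1,3) by (auto simp: canonical_def)
    ultimately show ?thesis
      by (auto simp: amp_is_def subst_amp_ground)
  qed
  finally show ?thesis .
qed

definition C_reducible :: "('a, 'c, 'f, 'x) strs \<Rightarrow> ('a, 'c, 'f, 'x) trm \<Rightarrow> bool" where
  "C_reducible S s \<longleftrightarrow> (\<exists>l r E \<sigma>. (l, r) \<in> rules S \<and> eval_ctx S E \<and> val_subst S \<sigma> \<and>
    s = fill E (subst \<sigma> l) \<and> classical s \<and> ground_term S s \<and> ground_term S (fill E (subst \<sigma> r)))"

lemma step_C_reducible: "step S N s t \<Longrightarrow> \<exists>w. C_reducible S w \<and> coef S s w \<noteq> 0"
proof (induction rule: step.induct)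
  case (C l r E \<sigma>)
  then have "C_reducible S (fill E (subst \<sigma> l))" unfolding C_reducible_def by blast
  then show ?case using C by (auto simp: coef_classical)
next
  case (E s t s' t')
  then show ?case using coef_equi by metis
next
  case (Q ss \<alpha>s ts i)
  then obtain w where w: "C_reducible S w" "coef S (ss ! i) w \<noteq> 0" by blast
  have i: "(\<alpha>s ! i, ss ! i) \<in> set (zip \<alpha>s ss)"
    using Q.hyps by (auto simp: set_zip)
  then have "classical (ss ! i)"
    using Q.hyps by (auto simp: canonical_def)
  then have "w = ss ! i"
    using w by (simp add: coef_classical split: if_splits)
  moreover have "coef S (lincomb (zip \<alpha>s ss)) (ss ! i) \<noteq> 0"
    using coef_canonical[of S "zip \<alpha>s ss" "\<alpha>s ! i"] i Q.hyps by (auto simp: ground_term_def)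
  ultimately show ?case using w by blast
qed

lemma classical_reducible_iff:
  assumes "classical s"
  shows "(\<exists>t. step S N s t) \<longleftrightarrow> C_reducible S s"
proof
  assume "\<exists>t. step S N s t"
  then obtain w where "C_reducible S w" "coef S s w \<noteq> 0"
    using step_C_reducible by metis
  then show "C_reducible S s"
    using assms by (simp add: coef_classical split: if_splits)
next
  assume "C_reducible S s"
  then show "\<exists>t. step S N s t"
    unfolding C_reducible_def by (auto intro: step.C)
qed

lemma step_mono:
  assumes "step S N s t" and "N \<inter> {t. classical t} \<subseteq> M"
  shows "step S M s t"
  using assms(1)
proof (induction rule: step.induct)
  case (Q ss \<alpha>s ts i)
  have "classical (ss ! j)" if "j < length \<alpha>s" for j
  proof -
    have "(\<alpha>s ! j, ss ! j) \<in> set (zip \<alpha>s ss)"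
      using Q.hyps that by (auto simp: set_zip)
    then show ?thesis
      using Q.hyps by (auto simp: canonical_def)
  qed
  then have "\<forall>j < length \<alpha>s. (ss ! j \<in> M \<and> ts ! j = ss ! j) \<or> step S M (ss ! j) (ts ! j)"
    using Q.IH assms(2) by blast
  then show ?case
    using Q by (intro step.Q[where i = i]) auto
qed (auto intro: step.C step.E)

lemma ex1_red: "\<exists>!R. R = step S (NF S R)"
proof -
  let ?N = "{s. ground_term S s \<and> \<not> C_reducible S s}"
  have NF: "NF S (step S N) \<inter> {s. classical s} = ?N \<inter> {s. classical s}" for N
    using classical_reducible_iff[of _ S N] by (auto simp: NF_def)
  have eq: "step S N = step S M" if "N \<inter> {s. classical s} = M \<inter> {s. classical s}" for N M
    using that by (intro ext iffI) (auto elim!: step_mono)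
  have fix_step: "step S ?N = step S (NF S (step S ?N))"
    by (rule eq) (rule NF[symmetric])
  show ?thesis
  proof (rule ex1I[of _ "step S ?N"])
    show "step S ?N = step S (NF S (step S ?N))" by (rule fix_step)
  next
    fix R assume R: "R = step S (NF S R)"
    have "NF S R \<inter> {s. classical s} = ?N \<inter> {s. classical s}"
      using NF[of "NF S R"] R[symmetric] by simp
    then have "step S (NF S R) = step S ?N" by (rule eq)
    then show "R = step S ?N" using R by simp
  qed
qed

lemma red_fixpoint: "red S = step S (NF S (red S))"
  unfolding red_def by (rule theI'[OF ex1_red])

definition red_opt ::
  "('a, 'c, 'f, 'x) strs \<Rightarrow> ('a, 'c, 'f, 'x) trm \<Rightarrow> ('a, 'c, 'f, 'x) trm \<Rightarrow> bool" where
  "red_opt S s t \<longleftrightarrow> (s \<in> NF S (red S) \<and> t = s) \<or> red S s t"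

text \<open>
  A reduction chain that can no longer be extended is represented as an infinite sequence that
  stays at its normal form.
\<close>

definition terminates_from :: "('a, 'c, 'f, 'x) strs \<Rightarrow> ('a, 'c, 'f, 'x) trm \<Rightarrow> bool" where
  "terminates_from S t \<longleftrightarrow>
    (\<exists>k. \<forall>g. g 0 = t \<and> (\<forall>i. red_opt S (g i) (g (Suc i))) \<longrightarrow> (\<exists>i \<le> k. g i \<in> NF S (red S)))"

definition terminates :: "('a, 'c, 'f, 'x) strs \<Rightarrow> bool" where
  "terminates S \<longleftrightarrow> (\<forall>t. ground_term S t \<longrightarrow> terminates_from S t)"


section \<open>Polynomials and assignments\<close>

text \<open>Polynomials with coefficients in \<open>\<nat>\<close> and indeterminates indexed by \<open>\<nat>\<close>, starting from \<open>0\<close>.\<close>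

type_synonym npoly = "(nat \<Rightarrow>\<^sub>0 nat) \<Rightarrow>\<^sub>0 nat"

definition indet :: "nat \<Rightarrow> npoly" where
  "indet i = Poly_Mapping.single (Poly_Mapping.single i 1) 1"

definition indets :: "npoly \<Rightarrow> nat set" where
  "indets P = (\<Union>m \<in> Poly_Mapping.keys P. Poly_Mapping.keys m)"

text \<open>Evaluation of a polynomial is the case \<open>'r = nat\<close>, composition the case \<open>'r = npoly\<close>.\<close>

definition insertion :: "(nat \<Rightarrow> 'r::comm_semiring_1) \<Rightarrow> npoly \<Rightarrow> 'r" where
  "insertion h P = (\<Sum>m \<in> Poly_Mapping.keys P.
    of_nat (Poly_Mapping.lookup P m) * (\<Prod>i \<in> Poly_Mapping.keys m. h i ^ Poly_Mapping.lookup m i))"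

definition poly_gt :: "npoly \<Rightarrow> npoly \<Rightarrow> bool" where
  "poly_gt P Q \<longleftrightarrow> (\<forall>\<nu> :: nat \<Rightarrow> nat. insertion \<nu> P > insertion \<nu> Q)"

definition poly_ge :: "npoly \<Rightarrow> npoly \<Rightarrow> bool" where
  "poly_ge P Q \<longleftrightarrow> (\<forall>\<nu> :: nat \<Rightarrow> nat. insertion \<nu> P \<ge> insertion \<nu> Q)"

definition assignment :: "('a, 'c, 'f, 'x) strs \<Rightarrow> (('c, 'f) symbol \<Rightarrow> npoly) \<Rightarrow> bool" where
  "assignment S A \<longleftrightarrow> (\<forall>b \<in> symbols S. indets (A b) \<subseteq> {..<arity S b})"

text \<open>
  The terms to which one of the three clauses extending an assignment to terms gives a value. A
  term such as \<open>\<alpha> \<cdot> t\<close> with \<open>\<alpha>\<close> of value \<open>0\<close> has no canonical form and gets none.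
\<close>

inductive interpretable :: "('a, 'c, 'f, 'x) strs \<Rightarrow> ('a, 'c, 'f, 'x) trm \<Rightarrow> bool" for S where
    interpretable_Var: "x \<in> variables S \<Longrightarrow> interpretable S (Var x)"
  | interpretable_App: "wf_term S (App b ts) \<Longrightarrow> \<forall>t \<in> set ts. interpretable S t
      \<Longrightarrow> interpretable S (App b ts)"
  | interpretable_can: "canonical S ps \<Longrightarrow> equi S t (lincomb ps) \<Longrightarrow> interpretable S t"

text \<open>
  The maximum in the third clause is an arbitrary polynomial upper bound, so an assignment \<open>A\<close>
  has many extensions \<open>I\<close> to terms. The values of \<open>I\<close> outside \<open>interpretable\<close> are irrelevant.
\<close>

definition extension :: "('a, 'c, 'f, 'x) strs \<Rightarrow> (('c, 'f) symbol \<Rightarrow> npoly) \<Rightarrow> ('x \<Rightarrow> nat) \<Rightarrow>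
    (('a, 'c, 'f, 'x) trm \<Rightarrow> npoly) \<Rightarrow> bool" where
  "extension S A \<rho> I \<longleftrightarrow>
    (\<forall>x \<in> variables S. I (Var x) = indet (\<rho> x)) \<and>
    (\<forall>b ts. wf_term S (App b ts) \<and> (\<forall>t \<in> set ts. interpretable S t) \<longrightarrow>
      I (App b ts) = insertion (\<lambda>i. I (ts ! i)) (A b)) \<and>
    (\<forall>t ps. canonical S ps \<and> equi S t (lincomb ps) \<longrightarrow>
      (\<forall>(\<alpha>, u) \<in> set ps. poly_ge (I t) (I u)))"

definition term_gt :: "('a, 'c, 'f, 'x) strs \<Rightarrow> (('a, 'c, 'f, 'x) trm \<Rightarrow> npoly) \<Rightarrow>
    ('a, 'c, 'f, 'x) trm \<Rightarrow> ('a, 'c, 'f, 'x) trm \<Rightarrow> bool" where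
  "term_gt S I s t \<longleftrightarrow> interpretable S s \<and> interpretable S t \<and> poly_gt (I s) (I t)"

definition monotonic ::
  "('a, 'c, 'f, 'x) strs \<Rightarrow> (('a, 'c, 'f, 'x) trm \<Rightarrow> npoly) \<Rightarrow> bool" where
  "monotonic S I \<longleftrightarrow>
    (\<forall>b us ws s t. wf_term S (App b (us @ s # ws)) \<and> wf_term S (App b (us @ t # ws)) \<and>
      (\<forall>u \<in> set us \<union> set ws. interpretable S u) \<and> term_gt S I s t \<longrightarrow>
      term_gt S I (App b (us @ s # ws)) (App b (us @ t # ws)))"

definition compatible ::
  "('a, 'c, 'f, 'x) strs \<Rightarrow> (('a, 'c, 'f, 'x) trm \<Rightarrow> npoly) \<Rightarrow> bool" where
  "compatible S I \<longleftrightarrow> (\<forall>(l, r) \<in> rules S. term_gt S I l r)"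

end

theory Submission
  imports Defs
begin

text \<open>
  A ground term is, up to equivalence, a formal combination of classical terms, with coefficients
  \<open>coef\<close>. Rule \<open>C\<close> replaces a classical term by a combination of classical terms of smaller value:
  \<open>l \<succ> r\<close> dominates every summand of an instance of \<open>r\<close>, and monotonicity passes the decrease
  through the evaluation context. Hence every step lowers the maximal value of the reducible
  classical terms in the support of \<open>coef\<close>, and this maximum bounds the length of all chains.
\<close>

section \<open>Evaluation of polynomials as a semiring homomorphism\<close>

lemma prod_keys_superset:
  fixes h :: "nat \<Rightarrow> 'r::comm_semiring_1"
  assumes "finite K" "Poly_Mapping.keys m \<subseteq> K"
  shows "(\<Prod>i\<in>Poly_Mapping.keys m. h i ^ Poly_Mapping.lookup m i)
    = (\<Prod>i\<in>K. h i ^ Poly_Mapping.lookup m i)"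
  using assms by (intro prod.mono_neutral_left) (auto simp: in_keys_iff)

lemma prod_keys_add:
  fixes h :: "nat \<Rightarrow> 'r::comm_semiring_1"
  shows "(\<Prod>i\<in>Poly_Mapping.keys (m + n). h i ^ Poly_Mapping.lookup (m + n) i)
    = (\<Prod>i\<in>Poly_Mapping.keys m. h i ^ Poly_Mapping.lookup m i)
      * (\<Prod>i\<in>Poly_Mapping.keys n. h i ^ Poly_Mapping.lookup n i)"
proof -
  \<comment> \<open>The three key sets differ, so all three products are taken over one common index
    set; the added factors have exponent 0.\<close>
  let ?K = "Poly_Mapping.keys m \<union> Poly_Mapping.keys n"
  have "finite ?K" by simp
  note superset = prod_keys_superset[OF this]
  show ?thesis
    unfolding superset[OF Poly_Mapping.keys_add] superset[of m, OF Un_upper1]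
      superset[of n, OF Un_upper2]
    by (simp add: lookup_add power_add prod.distrib)
qed

lemma insertion_superset:
  assumes "finite K" "Poly_Mapping.keys P \<subseteq> K"
  shows "insertion h P = (\<Sum>m\<in>K. of_nat (Poly_Mapping.lookup P m)
    * (\<Prod>i\<in>Poly_Mapping.keys m. h i ^ Poly_Mapping.lookup m i))"
  unfolding insertion_def using assms by (intro sum.mono_neutral_left) (auto simp: in_keys_iff)

lemma insertion_zero [simp]: "insertion h 0 = 0"
  by (simp add: insertion_def)

lemma insertion_add: "insertion h (P + Q) = insertion h P + insertion h Q"
proof -
  let ?K = "Poly_Mapping.keys P \<union> Poly_Mapping.keys Q"
  have "finite ?K" by simp
  note superset = insertion_superset[OF this]
  show ?thesis
    unfolding superset[OF Poly_Mapping.keys_add] superset[of P, OF Un_upper1]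
      superset[of Q, OF Un_upper2]
    by (simp add: lookup_add distrib_right sum.distrib)
qed

lemma insertion_single:
  "insertion h (Poly_Mapping.single m c)
    = of_nat c * (\<Prod>i\<in>Poly_Mapping.keys m. h i ^ Poly_Mapping.lookup m i)"
  by (simp add: insertion_def)

lemma insertion_sum: "insertion h (sum P B) = (\<Sum>x\<in>B. insertion h (P x))"
  by (induction B rule: infinite_finite_induct) (simp_all add: insertion_add)

lemma npoly_eq_sum:
  "(P :: npoly) = (\<Sum>m\<in>Poly_Mapping.keys P. Poly_Mapping.single m (Poly_Mapping.lookup P m))"
  by (rule poly_mapping_eqI) (simp add: lookup_sum lookup_single when_def in_keys_iff)

lemma insertion_mult: "insertion h (P * Q) = insertion h P * insertion h Q"
proof -
  have single: "insertion h (Poly_Mapping.single m c * Poly_Mapping.single n d)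
      = insertion h (Poly_Mapping.single m c) * insertion h (Poly_Mapping.single n d)" for m n c d
    by (simp add: mult_single insertion_single prod_keys_add ac_simps)
  \<comment> \<open>By distributivity it suffices to treat products of monomials, whose exponents
    add up.\<close>
  let ?P = "\<Sum>m\<in>Poly_Mapping.keys P. Poly_Mapping.single m (Poly_Mapping.lookup P m)"
  let ?Q = "\<Sum>m\<in>Poly_Mapping.keys Q. Poly_Mapping.single m (Poly_Mapping.lookup Q m)"
  have "insertion h (?P * ?Q) = insertion h ?P * insertion h ?Q"
    by (simp only: sum_product insertion_sum single)
  then show ?thesis
    by (simp only: npoly_eq_sum[symmetric])
qed

lemma insertion_one [simp]: "insertion h 1 = 1"
  by (simp add: insertion_single flip: single_one)

lemma insertion_of_nat [simp]: "insertion h (of_nat n) = of_nat n"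
  by (induction n) (simp_all add: insertion_add)

lemma insertion_power: "insertion h (P ^ n) = insertion h P ^ n"
  by (induction n) (simp_all add: insertion_mult)

lemma insertion_prod: "insertion h (prod P B) = (\<Prod>x\<in>B. insertion h (P x))"
  by (induction B rule: infinite_finite_induct) (simp_all add: insertion_mult)

text \<open>Evaluation is a homomorphism, so it commutes with composition. This turns the clause of
  \<open>extension\<close> for applications into a recursion on numbers.\<close>

lemma insertion_insertion: "insertion \<nu> (insertion h P) = insertion (\<lambda>i. insertion \<nu> (h i)) P"
  by (simp add: insertion_def[of h] insertion_def[of "\<lambda>i. insertion \<nu> (h i)"]
      insertion_sum insertion_mult insertion_prod insertion_power)

lemma insertion_indet [simp]: "insertion h (indet i) = h i"
  by (simp add: indet_def insertion_single)

lemma insertion_cong: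
  assumes "\<And>i. i \<in> indets P \<Longrightarrow> h i = k i"
  shows "insertion h P = insertion k P"
  unfolding insertion_def using assms
  by (intro sum.cong prod.cong arg_cong2[of _ _ _ _ "(*)"] arg_cong2[of _ _ _ _ "(^)"])
    (auto simp: indets_def)

text \<open>Coefficients in the naturals make every polynomial weakly monotone. Strict decrease
  inside a context has to come from \<open>monotonic\<close>.\<close>

lemma insertion_mono:
  fixes h k :: "nat \<Rightarrow> nat"
  assumes "\<And>i. i \<in> indets P \<Longrightarrow> h i \<le> k i"
  shows "insertion h P \<le> insertion k P"
  unfolding insertion_def using assms
  by (intro sum_mono mult_left_mono prod_mono conjI power_mono) (auto simp: indets_def)

\<comment> \<open>Ground terms, variables and substitution\<close>
inductive_simps wf_term_simps [simp]:
  "wf_term S (Var x)" "wf_term S (App b ts)" "wf_term S (Scale \<alpha> t)" "wf_term S (Plus s t)"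

lemma ground_term_App:
  "ground_term S (App b ts) \<longleftrightarrow>
    b \<in> symbols S \<and> length ts = arity S b \<and> (\<forall>t \<in> set ts. ground_term S t)"
  by (auto simp: ground_term_def)

lemma natexp_vars: "natexp S n \<Longrightarrow> vars n \<subseteq> variables S"
  by (induction rule: natexp.induct) auto

lemma amplitude_vars: "amplitude S \<alpha> \<Longrightarrow> amp_vars \<alpha> \<subseteq> variables S"
  unfolding amp_vars_def by (induction rule: amplitude.induct) (auto dest: natexp_vars)

lemma wf_term_vars: "wf_term S t \<Longrightarrow> vars t \<subseteq> variables S"
proof (induction rule: wf_term.induct)
  case (wf_Scale \<alpha> t)
  then show ?case using amplitude_vars[of S \<alpha>] by (auto simp: amp_vars_def)
qed auto

lemma val_vars: "val S v \<Longrightarrow> vars v = {}"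
  by (induction rule: val.induct) (auto simp: ground_amp_def amp_vars_def)

lemma subst_cong: "(\<And>x. x \<in> vars t \<Longrightarrow> \<sigma> x = \<tau> x) \<Longrightarrow> subst \<sigma> t = subst \<tau> t"
proof (induction t)
  case (Scale \<alpha> t)
  then have "map_amp id (subst \<sigma>) \<alpha> = map_amp id (subst \<tau>) \<alpha>"
    by (intro amp.map_cong) auto
  with Scale show ?case by simp
qed auto

lemma classical_subst:
  "classical t \<Longrightarrow> (\<And>x. x \<in> vars t \<Longrightarrow> classical (\<sigma> x)) \<Longrightarrow> classical (subst \<sigma> t)"
  by (induction t) (auto simp: list_all_iff)

lemma classical_subst_vars: "classical (subst \<sigma> t) \<Longrightarrow> x \<in> vars t \<Longrightarrow> classical (\<sigma> x)"
  by (induction t) (auto simp: list_all_iff)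

section \<open>The support of the formal combination denoted by a term\<close>

text \<open>The coefficient is a product of complex numbers, which vanishes only if a factor does.
  So the support of an application is formed argumentwise.\<close>

lemma coef_App_nonzero:
  "coef S (App b ts) u \<noteq> 0 \<longleftrightarrow>
    (\<exists>us. u = App b us \<and> length us = length ts \<and> (\<forall>i < length ts. coef S (ts ! i) (us ! i) \<noteq> 0))"
proof (cases "\<exists>us. u = App b us \<and> length us = length ts")
  case True
  then obtain us where u: "u = App b us" "length us = length ts" by blast
  then have "coef S (App b ts) u = 0 \<longleftrightarrow> 0 \<in> set (map2 (\<lambda>f v. f v) (map (coef S) ts) us)"
    by (simp add: prod_list_zero_iff)
  also have "\<dots> \<longleftrightarrow> (\<exists>i < length ts. coef S (ts ! i) (us ! i) = 0)"
    using u(2) by (auto simp: in_set_conv_nth simp del: set_map)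
  finally show ?thesis using u by auto
qed (cases u; auto)

lemma coef_nonzero_ground:
  assumes "ground_term S t" and "coef S t u \<noteq> 0"
  shows "ground_term S u \<and> classical u"
  using assms
proof (induction t arbitrary: u)
  case (App b ts)
  obtain us where u: "u = App b us" "length us = length ts"
      "\<forall>i < length ts. coef S (ts ! i) (us ! i) \<noteq> 0"
    using App.prems(2) unfolding coef_App_nonzero by blast
  have "ground_term S (us ! i) \<and> classical (us ! i)" if "i < length ts" for i
  proof (rule App.IH)
    show "ts ! i \<in> set ts" using that by simp
    then show "ground_term S (ts ! i)" using App.prems(1) by (simp add: ground_term_App)
    show "coef S (ts ! i) (us ! i) \<noteq> 0" using that u(3) by blast
  qed
  then have "\<forall>v \<in> set us. ground_term S v \<and> classical v"
    using u(2) by (metis in_set_conv_nth)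
  then show ?case
    using App.prems(1) u(1,2) by (simp add: ground_term_App list_all_iff)
next
  case (Scale \<alpha> t)
  have "ground_term S t" "coef S t u \<noteq> 0"
    using Scale.prems by (simp_all add: ground_term_def)
  then show ?case by (rule Scale.IH(2))
next
  case (Plus s t)
  have "coef S s u \<noteq> 0 \<or> coef S t u \<noteq> 0" using Plus.prems(2) by auto
  moreover have "ground_term S s" "ground_term S t"
    using Plus.prems(1) by (simp_all add: ground_term_def)
  ultimately show ?case using Plus.IH by blast
qed (simp add: ground_term_def)

text \<open>Only this direction holds in general: after instantiation, summands may coincide and
  cancel.\<close>

lemma coef_subst_lincomb_nonzero:
  "ps \<noteq> [] \<Longrightarrow> coef S (subst \<sigma> (lincomb ps)) u \<noteq> 0
    \<Longrightarrow> \<exists>(\<alpha>, t) \<in> set ps. coef S (subst \<sigma> t) u \<noteq> 0"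
proof (induction ps rule: lincomb.induct)
  case (2 \<alpha> t p ps)
  then show ?case by (cases "coef S (subst \<sigma> t) u = 0") auto
qed auto

lemma coef_lincomb_nonzero:
  "ps \<noteq> [] \<Longrightarrow> coef S (lincomb ps) u \<noteq> 0 \<Longrightarrow> \<exists>(\<alpha>, t) \<in> set ps. coef S t u \<noteq> 0"
proof (induction ps rule: lincomb.induct)
  case (2 \<alpha> t p ps)
  then show ?case by (cases "coef S t u = 0") auto
qed auto

section \<open>Numerals, and invariance of coefficients under substitution\<close>

lemma nat_of_numeral: "nat_of ((succ_trm ^^ k) zero_trm) = k"
  by (induction k) auto

lemma natexp_numeral: "natexp S ((succ_trm ^^ k) zero_trm)"
  by (induction k) (auto intro: natexp.intros)

lemma vars_numeral: "vars ((succ_trm ^^ k) zero_trm) = {}"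
  by (induction k) auto

lemma val_numeral: "val S ((succ_trm ^^ k) zero_trm)"
  by (induction k) (auto simp: cons_def intro!: val_App)

text \<open>
  The instance of an amplitude under a value substitution need not be an amplitude, so \<open>amp_is\<close>
  does not apply to it directly. But \<open>eval_amp\<close> reads its arguments through \<open>nat_of\<close> only, so
  replacing each value by the corresponding numeral yields a ground amplitude with the same value.
\<close>

lemma amp_is_subst:
  fixes S :: "('a, 'c, 'f, 'x) strs"
  assumes "amplitude S \<alpha>" and "amp_is S \<alpha> z" and "val_subst S \<sigma>"
  shows "eval_amp S (subst_amp (\<lambda>_. zero_trm) (subst_amp \<sigma> \<alpha>)) = z"
proof -
  define \<tau> :: "'x \<Rightarrow> ('a, 'c, 'f, 'x) trm"
    where "\<tau> x = (succ_trm ^^ nat_of (\<sigma> x)) zero_trm" for x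
  have nat_of: "nat_of (subst (\<lambda>_. zero_trm) (subst \<sigma> n)) = nat_of (subst \<tau> n)"
    if "natexp S n" for n
    using that
  proof (induction rule: natexp.induct)
    case (natexp_Var x)
    then have "vars (\<sigma> x) = {}"
      using assms(3) val_vars by (auto simp: val_subst_def)
    then show ?case by (simp add: subst_ground \<tau>_def nat_of_numeral)
  qed auto
  have natexp: "natexp S (subst \<tau> n) \<and> vars (subst \<tau> n) = {}" if "natexp S n" for n
    using that
    by (induction rule: natexp.induct)
      (auto simp: \<tau>_def natexp_numeral vars_numeral intro: natexp.intros)
  have "eval_amp S (subst_amp (\<lambda>_. zero_trm) (subst_amp \<sigma> \<alpha>)) = eval_amp S (subst_amp \<tau> \<alpha>)"
    using assms(1)
  proof (induction rule: amplitude.induct)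
    case (amplitude_Amp a ns)
    then show ?case
      by (auto simp: subst_amp_def nat_of intro!: arg_cong[where f = "amp_int S a"])
  qed (auto simp: subst_amp_def)
  moreover have "ground_amp S (subst_amp \<tau> \<alpha>)"
    using assms(1) unfolding ground_amp_def amp_vars_def subst_amp_def
    by (induction rule: amplitude.induct) (auto intro!: amplitude.intros simp: natexp)
  moreover have "val_subst S \<tau>"
    by (simp add: val_subst_def \<tau>_def val_numeral)
  ultimately show ?thesis
    using assms(2) by (auto simp: amp_is_def)
qed

text \<open>Instances of equivalent terms need not be well-formed, as a value put into an amplitude
  may not be a natural expression, so \<open>coef_equi\<close> cannot be applied to them. Instead
  each equation is checked on coefficients, which are linear in every argument by
  \<open>coef_App_split\<close>.\<close>

lemma coef_subst_equi:
  assumes "equi S s t" and "val_subst S \<sigma>"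
  shows "coef S (subst \<sigma> s) = coef S (subst \<sigma> t)"
  using assms(1)
proof (induction rule: equi.induct)
  case (equi_App s t b us ws)
  show ?case
  proof
    fix u
    obtain K where "\<forall>t. coef S (App b (map (subst \<sigma>) us @ t # map (subst \<sigma>) ws)) u
        = K * (case u of App b' vs \<Rightarrow> coef S t (vs ! length (map (subst \<sigma>) us)) | _ \<Rightarrow> 0)"
      using coef_App_split[of S b "map (subst \<sigma>) us" "map (subst \<sigma>) ws" u] by blast
    then show "coef S (subst \<sigma> (App b (us @ s # ws))) u = coef S (subst \<sigma> (App b (us @ t # ws))) u"
      using equi_App.IH by (simp del: coef.simps(2) split: trm.split)
  qed
next
  case (add_null s \<alpha> t)
  then show ?case
    using amp_is_subst[of S \<alpha> 0 \<sigma>] assms(2) by (auto simp: subst_amp_def)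
next
  case (scale_one \<alpha> t)
  then show ?case
    using amp_is_subst[of S \<alpha> 1 \<sigma>] assms(2) by (auto simp: subst_amp_def)
next
  case (App_scale b us \<alpha> t ws)
  show ?case
  proof
    fix u
    obtain K where "\<forall>t. coef S (App b (map (subst \<sigma>) us @ t # map (subst \<sigma>) ws)) u
        = K * (case u of App b' vs \<Rightarrow> coef S t (vs ! length (map (subst \<sigma>) us)) | _ \<Rightarrow> 0)"
      using coef_App_split[of S b "map (subst \<sigma>) us" "map (subst \<sigma>) ws" u] by blast
    then show "coef S (subst \<sigma> (App b (us @ Scale \<alpha> t # ws))) u
        = coef S (subst \<sigma> (Scale \<alpha> (App b (us @ t # ws)))) u"
      by (simp add: coef.simps(3) del: coef.simps(2) split: trm.split)
  qed
next
  case (App_add b us s t ws)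
  show ?case
  proof
    fix u
    obtain K where "\<forall>t. coef S (App b (map (subst \<sigma>) us @ t # map (subst \<sigma>) ws)) u
        = K * (case u of App b' vs \<Rightarrow> coef S t (vs ! length (map (subst \<sigma>) us)) | _ \<Rightarrow> 0)"
      using coef_App_split[of S b "map (subst \<sigma>) us" "map (subst \<sigma>) ws" u] by blast
    then show "coef S (subst \<sigma> (App b (us @ Plus s t # ws))) u
        = coef S (subst \<sigma> (Plus (App b (us @ s # ws)) (App b (us @ t # ws)))) u"
      by (simp add: algebra_simps del: coef.simps(2) split: trm.split)
  qed
qed (auto simp: subst_amp_def algebra_simps)

section \<open>Values of ground classical terms, compared with the extension
  \<open>I\<close>\<close>

text \<open>Meaningful on ground classical terms only; the other clauses give the junk value \<open>0\<close>.\<close>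

primrec gval :: "(('c, 'f) symbol \<Rightarrow> npoly) \<Rightarrow> ('a, 'c, 'f, 'x) trm \<Rightarrow> nat" where
    "gval A (Var x) = 0"
  | "gval A (App b ts) = insertion (\<lambda>i. if i < length ts then map (gval A) ts ! i else 0) (A b)"
  | "gval A (Scale \<alpha> t) = 0"
  | "gval A (Plus s t) = 0"

text \<open>The padding by 0 matches \<open>gval\<close>; it is harmless because the indeterminates
  of \<open>A b\<close> lie below the arity.\<close>

lemma insertion_I_App:
  assumes "assignment S A" and "extension S A \<rho> I"
    and "wf_term S (App b ts)" and "\<forall>t \<in> set ts. interpretable S t"
  shows "insertion \<nu> (I (App b ts))
    = insertion (\<lambda>i. if i < length ts then insertion \<nu> (I (ts ! i)) else 0) (A b)"
proof -
  have "insertion \<nu> (I (App b ts)) = insertion (\<lambda>i. insertion \<nu> (I (ts ! i))) (A b)"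
    using assms(2-4) unfolding extension_def by (simp add: insertion_insertion)
  also have "\<dots> = insertion (\<lambda>i. if i < length ts then insertion \<nu> (I (ts ! i)) else 0) (A b)"
    using assms(1,3) by (intro insertion_cong) (auto simp: assignment_def)
  finally show ?thesis .
qed

lemma interpretable_classical: "wf_term S t \<Longrightarrow> classical t \<Longrightarrow> interpretable S t"
proof (induction rule: wf_term.induct)
  case (wf_App b ts)
  then show ?case by (intro interpretable_App) (auto simp: list_all_iff)
qed (auto intro: interpretable_Var)

text \<open>On classical terms the clauses for variables and applications determine
  \<open>I\<close>. The valuation \<nu> gives each indeterminate the value of the term substituted
  for its variable.\<close>

lemma insertion_I_classical:
  assumes "assignment S A" and "extension S A \<rho> I"
    and "wf_term S t" and "classical t" and "\<forall>x \<in> vars t. \<nu> (\<rho> x) = gval A (\<sigma> x)"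
  shows "insertion \<nu> (I t) = gval A (subst \<sigma> t)"
  using assms(3-5)
proof (induction rule: wf_term.induct)
  case (wf_Var x)
  then show ?case using assms(2) by (simp add: extension_def)
next
  case (wf_App b ts)
  then have "\<forall>t \<in> set ts. interpretable S t"
    by (auto intro: interpretable_classical simp: list_all_iff)
  then have "insertion \<nu> (I (App b ts))
      = insertion (\<lambda>i. if i < length ts then insertion \<nu> (I (ts ! i)) else 0) (A b)"
    using wf_App by (intro insertion_I_App[OF assms(1,2)]) auto
  also have "\<dots> = gval A (subst \<sigma> (App b ts))"
    using wf_App by (auto simp: list_all_iff intro!: insertion_cong)
  finally show ?case .
qed auto

lemma insertion_I_ground:
  assumes "assignment S A" and "extension S A \<rho> I" and "ground_term S t" and "classical t"
  shows "insertion \<nu> (I t) = gval A t"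
  \<comment> \<open>Without variables, any substitution leaves \<open>t\<close> unchanged;
    \<open>Var\<close> is an arbitrary choice.\<close>
  using insertion_I_classical[OF assms(1,2), of t \<nu> Var] assms(3,4)
  by (simp add: ground_term_def subst_ground)

text \<open>Only an inequality, since \<open>I\<close> is merely an upper bound on canonical forms.
  Applications use weak monotonicity. For a canonical form, \<open>coef_subst_equi\<close> places
  \<open>u\<close> in the support of the instance of one summand; that instance is classical, so it
  is \<open>u\<close> itself.\<close>

lemma gval_le_insertion_I:
  assumes "assignment S A" and "extension S A \<rho> I" and "interpretable S t"
    and "val_subst S \<sigma>" and "\<forall>x \<in> variables S. classical (\<sigma> x)"
    and "\<forall>x \<in> variables S. \<nu> (\<rho> x) = gval A (\<sigma> x)"
    and "coef S (subst \<sigma> t) u \<noteq> 0"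
  shows "gval A u \<le> insertion \<nu> (I t)"
  using assms(3,7)
proof (induction arbitrary: u rule: interpretable.induct)
  case (interpretable_Var x)
  then have "u = \<sigma> x"
    using assms(5) by (auto simp: coef_classical split: if_splits)
  then show ?case
    using interpretable_Var assms(2,6) by (simp add: extension_def)
next
  case (interpretable_App b ts)
  have "coef S (App b (map (subst \<sigma>) ts)) u \<noteq> 0"
    using interpretable_App.prems by (simp only: subst.simps not_False_eq_True)
  then obtain us where u: "u = App b us" "length us = length ts"
      "\<forall>i < length ts. coef S (subst \<sigma> (ts ! i)) (us ! i) \<noteq> 0"
    unfolding coef_App_nonzero by auto
  have "gval A u \<le> insertion (\<lambda>i. if i < length ts then insertion \<nu> (I (ts ! i)) else 0) (A b)"
    unfolding u(1) gval.simps using u interpretable_App.IH by (intro insertion_mono) auto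
  then show ?case
    using interpretable_App by (subst insertion_I_App[OF assms(1,2)]) auto
next
  case (interpretable_can ps t)
  then have "ps \<noteq> []" and "coef S (subst \<sigma> (lincomb ps)) u \<noteq> 0"
    using coef_subst_equi assms(4) by (force simp: canonical_def)+
  then obtain \<alpha> v where v: "(\<alpha>, v) \<in> set ps" "coef S (subst \<sigma> v) u \<noteq> 0"
    using coef_subst_lincomb_nonzero by blast
  then have wf: "wf_term S v" and cl: "classical v"
    using interpretable_can(1) by (auto simp: canonical_def)
  have "vars v \<subseteq> variables S"
    using wf by (rule wf_term_vars)
  then have "classical (subst \<sigma> v)"
    using cl assms(5) by (intro classical_subst) auto
  then have "gval A u = insertion \<nu> (I v)"
    using v insertion_I_classical[OF assms(1,2) wf cl, of \<nu> \<sigma>] assms(6) \<open>vars v \<subseteq> variables S\<close>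
    by (auto simp: coef_classical subset_iff split: if_splits)
  also have "\<dots> \<le> insertion \<nu> (I t)"
    using assms(2) interpretable_can v unfolding extension_def poly_ge_def by fast
  finally show ?case .
qed

section \<open>Strict decrease along rules, contexts and steps\<close>

lemma gval_rule:
  assumes "is_strs S" and "assignment S A" and "inj_on \<rho> (variables S)"
    and "extension S A \<rho> I" and "compatible S I"
    and "(l, r) \<in> rules S" and "val_subst S \<sigma>" and "classical (subst \<sigma> l)"
    and "coef S (subst \<sigma> r) u \<noteq> 0"
  shows "gval A u < gval A (subst \<sigma> l)"
proof -
  have rule: "is_rule S l r"
    using assms(1,6) by (auto simp: is_strs_def)
  then have wf: "wf_term S l" and vr: "vars r \<subseteq> vars l" and cl: "classical l"
    by (auto simp: is_rule_def list_all_iff)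
  have vl: "vars l \<subseteq> variables S"
    using wf by (rule wf_term_vars)
  \<comment> \<open>Classicality of the instance of \<open>l\<close> controls \<sigma> only on
    \<open>vars l\<close>. Elsewhere a classical value is substituted; both instances stay the same
    because \<open>vars r\<close> \<subseteq> \<open>vars l\<close>.\<close>
  define \<tau> where "\<tau> x = (if x \<in> vars l then \<sigma> x else zero_trm)" for x
  have \<tau>: "val_subst S \<tau>" "\<forall>x \<in> variables S. classical (\<tau> x)"
    using assms(7,8) by (auto simp: val_subst_def \<tau>_def val_zero dest: classical_subst_vars)
  \<comment> \<open>The valuation reads the variable back from its indeterminate, which is where
    injectivity of \<rho> enters.\<close>
  define \<nu> where "\<nu> n = gval A (\<tau> (inv_into (variables S) \<rho> n))" for n
  have \<nu>: "\<forall>x \<in> variables S. \<nu> (\<rho> x) = gval A (\<tau> x)"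
    using assms(3) by (simp add: \<nu>_def)
  have l: "subst \<sigma> l = subst \<tau> l" and r: "subst \<sigma> r = subst \<tau> r"
    using vr by (auto intro!: subst_cong simp: \<tau>_def)
  have "term_gt S I l r"
    using assms(5,6) by (auto simp: compatible_def)
  then have "interpretable S r" and "insertion \<nu> (I r) < insertion \<nu> (I l)"
    by (auto simp: term_gt_def poly_gt_def)
  moreover have "gval A u \<le> insertion \<nu> (I r)"
    using gval_le_insertion_I[OF assms(2,4) \<open>interpretable S r\<close> \<tau> \<nu>] assms(9) r by simp
  moreover have "insertion \<nu> (I l) = gval A (subst \<sigma> l)"
    using insertion_I_classical[OF assms(2,4) wf cl] \<nu> vl l by auto
  ultimately show ?thesis by simp
qed

text \<open>On ground classical terms \<open>I\<close> evaluates to the constant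
  \<open>gval\<close>, so comparing values amounts to \<open>term_gt\<close>, and
  \<open>monotonic\<close> applies.\<close>

lemma gval_App_strict:
  assumes "assignment S A" and "extension S A \<rho> I" and "monotonic S I"
    and "ground_term S (App b (us @ s # ws))" and "classical (App b (us @ s # ws))"
    and "ground_term S t" and "classical t" and "gval A t < gval A s"
  shows "gval A (App b (us @ t # ws)) < gval A (App b (us @ s # ws))"
proof -
  have g: "ground_term S (App b (us @ t # ws))" "classical (App b (us @ t # ws))"
    using assms(4-7) by (auto simp: ground_term_App)
  have "\<forall>u \<in> set us \<union> set ws. interpretable S u"
    using assms(4,5) by (auto simp: ground_term_App ground_term_def list_all_iff
        intro: interpretable_classical)
  moreover have "term_gt S I s t"
    using assms(4-8) insertion_I_ground[OF assms(1,2), of s] insertion_I_ground[OF assms(1,2), of t]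
    by (auto simp: term_gt_def poly_gt_def ground_term_App ground_term_def
        intro: interpretable_classical)
  ultimately have "term_gt S I (App b (us @ s # ws)) (App b (us @ t # ws))"
    using assms(3,4) g(1) unfolding monotonic_def ground_term_def by blast
  then show ?thesis
    using insertion_I_ground[OF assms(1,2) assms(4,5)] insertion_I_ground[OF assms(1,2) g]
    by (auto simp: term_gt_def poly_gt_def)
qed

text \<open>Induction on the context, each layer being one use of
  \<open>gval_App_strict\<close>.\<close>

lemma gval_fill:
  assumes "assignment S A" and "extension S A \<rho> I" and "monotonic S I"
    and "\<And>u. coef S t u \<noteq> 0 \<Longrightarrow> gval A u < gval A s"
    and "ground_term S (fill E s)" and "classical (fill E s)" and "ground_term S (fill E t)"
    and "coef S (fill E t) u \<noteq> 0"
  shows "gval A u < gval A (fill E s)"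
  using assms(5-8)
proof (induction E arbitrary: u)
  case Hole
  then show ?case using assms(4) by simp
next
  case (CApp b vs E ts)
  let ?f = "fill E t"
  obtain us where u: "u = App b us" "length us = length (vs @ ?f # ts)"
      "\<forall>i < length (vs @ ?f # ts). coef S ((vs @ ?f # ts) ! i) (us ! i) \<noteq> 0"
    using CApp.prems(4) unfolding fill.simps coef_App_nonzero by blast
  define w where "w = us ! length vs"
  have w: "coef S ?f w \<noteq> 0"
    using u(3)[rule_format, of "length vs"] by (simp add: w_def)
  \<comment> \<open>The siblings of the hole are classical, so each has only itself in its support.
    Hence \<open>u\<close> can differ from the source only at the hole.\<close>
  have "us = vs @ w # ts"
  proof (rule nth_equalityI)
    show "length us = length (vs @ w # ts)" using u(2) by simp
    fix i assume i: "i < length us"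
    show "us ! i = (vs @ w # ts) ! i"
    proof (cases "i = length vs")
      case False
      then have eq: "(vs @ ?f # ts) ! i = (vs @ w # ts) ! i"
        by (cases "i < length vs") (auto simp: nth_append nth_Cons')
      have "(vs @ w # ts) ! i \<in> set vs \<union> set ts"
        using i u(2) False by (auto simp: nth_append nth_Cons')
      then have "classical ((vs @ w # ts) ! i)"
        using CApp.prems(2) by (auto simp: list_all_iff)
      then show ?thesis
        using u(2) u(3)[rule_format, of i] i eq by (auto simp: coef_classical split: if_splits)
    qed (simp add: w_def)
  qed
  moreover have "gval A w < gval A (fill E s)"
    using CApp w by (auto simp: ground_term_App)
  moreover have "ground_term S w \<and> classical w"
    using w CApp.prems(3) by (intro coef_nonzero_ground) (auto simp: ground_term_App)
  ultimately show ?case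
    using gval_App_strict[OF assms(1-3), of b vs "fill E s" ts w] CApp.prems(1,2) u(1) by simp
qed

text \<open>
  Normal forms may stay in a superposition with an arbitrarily large value, so only the reducible
  summands are measured. In rule \<open>Q\<close> all of them have to be reduced, hence each reducible summand
  of the result stems from a larger reducible summand of the source.
\<close>

lemma step_gval_less:
  assumes "is_strs S" and "assignment S A" and "inj_on \<rho> (variables S)"
    and "extension S A \<rho> I" and "monotonic S I" and "compatible S I"
    and "step S N s t" and "N \<inter> Collect (C_reducible S) = {}"
    and "coef S t u \<noteq> 0" and "C_reducible S u"
  shows "\<exists>w. C_reducible S w \<and> coef S s w \<noteq> 0 \<and> gval A u < gval A w"
  using assms(7,9)
proof (induction rule: step.induct)
  case (C l r E \<sigma>)
  have "classical (subst \<sigma> l)" if "classical (fill E (subst \<sigma> l))"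
    using that by (induction E) (auto simp: list_all_iff)
  then have "gval A u < gval A (fill E (subst \<sigma> l))"
    using C by (intro gval_fill[OF assms(2,4,5) gval_rule[OF assms(1-4,6)]])
  moreover have "C_reducible S (fill E (subst \<sigma> l))"
    using C unfolding C_reducible_def by blast
  moreover have "coef S (fill E (subst \<sigma> l)) (fill E (subst \<sigma> l)) \<noteq> 0"
    using C by (simp add: coef_classical)
  ultimately show ?case by blast
next
  case (E s t s' t')
  then show ?case by (metis coef_equi)
next
  case (Q ss \<alpha>s ts i)
  have "zip \<alpha>s ts \<noteq> []"
    using Q.hyps by (cases \<alpha>s; cases ts) auto
  then obtain \<alpha> v where "(\<alpha>, v) \<in> set (zip \<alpha>s ts)" and v: "coef S v u \<noteq> 0"
    using coef_lincomb_nonzero Q.prems by blast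
  then obtain j where j: "j < length \<alpha>s" "ts ! j = v"
    by (auto simp: set_zip)
  have mem: "(\<alpha>s ! j, ss ! j) \<in> set (zip \<alpha>s ss)"
    using Q.hyps j by (auto simp: set_zip)
  then have cl: "classical (ss ! j)"
    using Q.hyps by (auto simp: canonical_def)
  \<comment> \<open>Were the summand kept as a normal form, it would equal \<open>u\<close>, a
    reducible term in \<open>N\<close>.\<close>
  have "ss ! j \<notin> N \<or> ts ! j \<noteq> ss ! j"
    using cl v j assms(8,10) by (auto simp: coef_classical split: if_splits)
  then obtain w where w: "C_reducible S w" "coef S (ss ! j) w \<noteq> 0" "gval A u < gval A w"
    using Q.IH j v by blast
  then have "w = ss ! j"
    using cl by (simp add: coef_classical split: if_splits)
  \<comment> \<open>Distinct classical summands with nonzero amplitudes cannot cancel in the source.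
    Cancellation in the result would only shrink its support.\<close>
  moreover have "coef S (lincomb (zip \<alpha>s ss)) (ss ! j) \<noteq> 0"
    using coef_canonical[OF _ _ mem] Q.hyps by (auto simp: ground_term_def)
  ultimately show ?case using w by blast
qed

section \<open>The initial bound, and termination\<close>

text \<open>For an application, the bounds of the arguments are inserted into \<open>A b\<close> and
  weak monotonicity is used.\<close>

lemma gval_bounded: "\<exists>m. \<forall>u. coef S t u \<noteq> 0 \<longrightarrow> gval A u < m"
proof (induction t)
  case (Var x)
  then show ?case by (intro exI[of _ 1]) auto
next
  case (App b ts)
  then obtain m where m: "\<And>t u. t \<in> set ts \<Longrightarrow> coef S t u \<noteq> 0 \<Longrightarrow> gval A u < m t"
    by metis
  define k where "k = (\<lambda>i. if i < length ts then m (ts ! i) else 0)"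
  have "gval A u \<le> insertion k (A b)" if nz: "coef S (App b ts) u \<noteq> 0" for u
  proof -
    obtain us where u: "u = App b us" "length us = length ts"
        "\<forall>i < length ts. coef S (ts ! i) (us ! i) \<noteq> 0"
      using nz unfolding coef_App_nonzero by blast
    have "gval A (us ! i) \<le> m (ts ! i)" if "i < length ts" for i
      using m[of "ts ! i" "us ! i"] u(3) that by (simp add: less_imp_le)
    then show ?thesis
      unfolding u(1) gval.simps using u(2) by (intro insertion_mono) (simp add: k_def)
  qed
  then show ?case by (intro exI[of _ "Suc (insertion k (A b))"]) (auto simp: less_Suc_eq_le)
next
  case (Plus s t)
  then obtain m n where m: "\<forall>u. coef S s u \<noteq> 0 \<longrightarrow> gval A u < m"
      and n: "\<forall>u. coef S t u \<noteq> 0 \<longrightarrow> gval A u < n"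
    by blast
  have "gval A u < max m n" if "coef S (Plus s t) u \<noteq> 0" for u
  proof -
    have "coef S s u \<noteq> 0 \<or> coef S t u \<noteq> 0" using that by auto
    then show ?thesis using m n by (auto simp: less_max_iff_disj)
  qed
  then show ?case by blast
qed auto

lemma step_ground: "step S N s t \<Longrightarrow> ground_term S t"
  by (induction rule: step.induct) auto

text \<open>Supplies the condition on \<open>N\<close> in \<open>step_gval_less\<close>: a
  C-reducible term is classical and has a step, whatever \<open>N\<close> is.\<close>

lemma NF_not_C_reducible: "NF S (step S N) \<inter> Collect (C_reducible S) = {}"
proof -
  have "classical u" if "C_reducible S u" for u
    using that unfolding C_reducible_def by blast
  then show ?thesis
    using classical_reducible_iff[of _ S N] by (auto simp: NF_def)
qed

theorem theorem32:
  fixes S :: "('a, 'c, 'f, 'x) strs"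
    and A :: "('c, 'f) symbol \<Rightarrow> npoly"
    and \<rho> :: "'x \<Rightarrow> nat"
    and I :: "('a, 'c, 'f, 'x) trm \<Rightarrow> npoly"
  assumes "is_strs S"
    and "assignment S A"
    and "inj_on \<rho> (variables S)"
    and "extension S A \<rho> I"
    and "monotonic S I"
    and "compatible S I"
  shows "terminates S"
proof -
  note step_less = step_gval_less[OF assms]
  \<comment> \<open>The bound \<open>m\<close> is strict, so it drops by one per step, and
    \<open>m = 0\<close> leaves no reducible summand.\<close>
  have bound: "\<exists>i \<le> m. g i \<in> NF S (red S)"
    if "ground_term S (g 0)" and "\<forall>u. C_reducible S u \<and> coef S (g 0) u \<noteq> 0 \<longrightarrow> gval A u < m"
      and "\<forall>i. red_opt S (g i) (g (Suc i))" for m g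
    using that
  proof (induction m arbitrary: g)
    case 0
    \<comment> \<open>Any step would need a C-reducible term in the support, by
      \<open>step_C_reducible\<close>.\<close>
    then have "\<not> red S (g 0) t" for t
      using step_C_reducible[of S "NF S (red S)" "g 0" t] red_fixpoint[of S] by auto
    then show ?case using 0 by (auto simp: NF_def)
  next
    case (Suc m)
    show ?case
    proof (cases "g 0 \<in> NF S (red S)")
      case False
      \<comment> \<open>Outside normal forms the chain cannot stay put, so \<open>red_opt\<close> is
        a genuine step.\<close>
      then have step: "step S (NF S (red S)) (g 0) (g 1)"
        using Suc.prems(3)[rule_format, of 0] red_fixpoint[of S] by (simp add: red_opt_def)
      have "NF S (red S) \<inter> Collect (C_reducible S) = {}"
        using NF_not_C_reducible[of S "NF S (red S)"] red_fixpoint[of S] by simp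
      then have "\<forall>u. C_reducible S u \<and> coef S (g 1) u \<noteq> 0 \<longrightarrow> gval A u < m"
        using step_less[OF step] Suc.prems(2) by (meson less_Suc_eq_le order_less_le_trans)
      then have "\<exists>i \<le> m. g (Suc i) \<in> NF S (red S)"
        using Suc.IH[of "\<lambda>i. g (Suc i)"] step_ground[OF step] Suc.prems(3) by simp
      then show ?thesis by (meson Suc_le_mono)
    qed blast
  qed
  have "terminates_from S t" if "ground_term S t" for t
  proof -
    \<comment> \<open>This bound depends on \<open>t\<close> alone, so it serves as the uniform
      \<open>k\<close> for all chains from \<open>t\<close>.\<close>
    obtain m where "\<forall>u. coef S t u \<noteq> 0 \<longrightarrow> gval A u < m"
      using gval_bounded[of S t A] by blast
    then show ?thesis
      unfolding terminates_from_def using bound that by blast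
  qed
  then show ?thesis by (simp add: terminates_def)
qed

end
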